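(* Let $n\ge 1$ and let $D\subset\mathbb{RP}^n$ be an open or compact properly convex set. Then $$(D^e)^*=(D^* )^e,$$ where $D^*\subset(\mathbb{RP}^n)^*$ is the (real) dual complement of $D$, $(D^* )^e\subset(\mathbb{CP}^n)^*$ is its elliptic tube, and $(D^e)^*\subset(\mathbb{CP}^n)^*$ is the (complex) dual complement of the elliptic tube $D^e\subset\mathbb{CP}^n$.
   Context: A set $E\subset\mathbb{RP}^n$ is convex if it contains no projective line and its intersection with every projective line is connected. A convex set $E\subset\mathbb{RP}^n$ is properly convex if it is not contained in a projective hyperplane and contains no affine line (a projective line minus a point). Dual complement: for a projective space $\mathbb{P}=\mathbb{P}(V)$ over $\mathbb{K}=\mathbb{R}$ or $\mathbb{C}$, with dual $\mathbb{P}^*=\mathbb{P}(V^* )$, and $E\subset\mathbb{P}$, put $E^*=\{\xi\in\mathbb{P}^* : \ker(\xi)\cap E=\emptyset\}$, where $\ker(\xi)\subset\mathbb{P}$ is the projective hyperplane defined by $\xi$. Elliptic tubes: regard $\mathbb{RP}^n\subset\mathbb{CP}^n$ and write $\pi$ for the projections $\mathbb{R}^{n+1}\setminus\{0\}\to\mathbb{RP}^n$, $\mathbb{C}^{n+1}\setminus\{0\}\to\mathbb{CP}^n$. A closed segment $I\subset\mathbb{RP}^n$ with endpoints $a_0,a_1$ can be written as $I=\pi(\{c_0v_0+c_1v_1\neq 0 : c_0,c_1\in\mathbb{R},\ c_0c_1\ge 0\})$ for suitable $v_0,v_1\in\mathbb{R}^{n+1}$ with $\pi(v_i)=a_i$;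 put $I^e=\pi(\{c_0v_0+c_1v_1\neq 0 : c_0,c_1\in\mathbb{C},\ \mathrm{Re}(c_0\overline{c_1})\ge 0\})$. For $D\subset\mathbb{RP}^n$, the elliptic tube is $D^e=\bigcup\{I^e : I\subset D \text{ a closed segment}\}\subset\mathbb{CP}^n$. The same definition applies in the dual projective spaces $(\mathbb{RP}^n)^*\subset(\mathbb{CP}^n)^*$. *)

theory Defs
  imports "HOL-Analysis.Analysis"
begin

text \<open>
  The projective space of \<open>K^(n+1)\<close>, where \<open>K^(n+1)\<close> is \<open>'a ^ 'n\<close> with \<open>CARD('n) = n + 1\<close>,
  as the set of its one-dimensional linear subspaces. Here \<open>vec.span\<close> is the span over \<open>'a\<close>
  itself (so the complex span for \<open>'a = complex\<close>), unlike \<open>span\<close>, which is the real span.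
\<close>

typedef (overloaded) ('a::field, 'n::finite) proj =
  "{L :: ('a ^ 'n) set. \<exists>v. v \<noteq> 0 \<and> L = vec.span {v}}"
  morphisms line_of Abs_proj
proof -
  have "(\<chi> i. 1) \<noteq> (0 :: 'a ^ 'n)" by (simp add: vec_eq_iff)
  then show ?thesis by blast
qed

text \<open>The projection \<open>\<pi>\<close>; its value at \<open>0\<close> is meaningless and never used below.\<close>

definition proj_of :: "'a::field ^ 'n \<Rightarrow> ('a, 'n::finite) proj" where
  "proj_of v = Abs_proj (vec.span {v})"

lemma line_of_proj_of: "v \<noteq> 0 \<Longrightarrow> line_of (proj_of v) = vec.span {v}"
  unfolding proj_of_def by (rule Abs_proj_inverse) blast

text \<open>The quotient topology from \<open>K^(n+1) - {0}\<close>.\<close>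

instantiation proj :: (real_normed_field, finite) topological_space
begin

definition open_proj :: "('a, 'b) proj set \<Rightarrow> bool" where
  "open_proj U \<longleftrightarrow> open {v :: 'a ^ 'b. v \<noteq> 0 \<and> proj_of v \<in> U}"

instance
proof
  have "{v :: 'a ^ 'b. v \<noteq> 0} = - {0}" by auto
  then show "open (UNIV :: ('a, 'b) proj set)"
    unfolding open_proj_def by (simp add: open_Compl)
next
  fix S T :: "('a, 'b) proj set"
  assume "open S" "open T"
  moreover have "{v :: 'a ^ 'b. v \<noteq> 0 \<and> proj_of v \<in> S \<inter> T} =
      {v. v \<noteq> 0 \<and> proj_of v \<in> S} \<inter> {v. v \<noteq> 0 \<and> proj_of v \<in> T}" by auto
  ultimately show "open (S \<inter> T)"
    unfolding open_proj_def by (simp add: open_Int)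
next
  fix K :: "('a, 'b) proj set set"
  assume *: "\<forall>S\<in>K. open S"
  have "{v :: 'a ^ 'b. v \<noteq> 0 \<and> proj_of v \<in> \<Union>K} =
      (\<Union>S\<in>K. {v. v \<noteq> 0 \<and> proj_of v \<in> S})" by auto
  with * show "open (\<Union>K)"
    unfolding open_proj_def by (simp add: open_UN)
qed

end

text \<open>
  The dual space of \<open>K^(n+1)\<close> is identified with \<open>K^(n+1)\<close> by letting the coordinate vector
  \<open>w\<close> act through the bilinear (for complex scalars not Hermitian) pairing below. This is a
  bijection onto the linear functionals, it carries the dual projective space to
  \<open>('a, 'n) proj\<close>, and it is compatible with the inclusion of the real into the complex
  (dual) space.
\<close>

definition pairing :: "'a::field ^ 'n \<Rightarrow> 'a ^ 'n::finite \<Rightarrow> 'a" where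
  "pairing w x = (\<Sum>i\<in>UNIV. w $ i * x $ i)"

lemma linear_functional_iff_pairing:
  fixes f :: "'a::field ^ 'n::finite \<Rightarrow> 'a"
  shows "Vector_Spaces.linear (*s) (*) f \<longleftrightarrow> (\<exists>!w. f = pairing w)"
proof
  assume lin: "Vector_Spaces.linear (*s) (*) f"
  then interpret f: Vector_Spaces.linear "(*s) :: 'a \<Rightarrow> 'a ^ 'n \<Rightarrow> 'a ^ 'n" "(*)" f .
  have coord: "pairing w (axis i 1) = w $ i" for w :: "'a ^ 'n" and i
    by (simp add: pairing_def axis_def if_distrib cong: if_cong)
  have "f x = pairing (\<chi> i. f (axis i 1)) x" for x
  proof -
    have "f x = f (\<Sum>i\<in>UNIV. (x $ i) *s axis i 1)"
      by (simp only: basis_expansion)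
    also have "\<dots> = (\<Sum>i\<in>UNIV. x $ i * f (axis i 1))"
      by (simp only: f.sum f.scale)
    finally show ?thesis
      by (simp add: pairing_def mult.commute)
  qed
  then have ex: "f = pairing (\<chi> i. f (axis i 1))"
    by blast
  have "w = (\<chi> i. f (axis i 1))" if "f = pairing w" for w
    unfolding that by (simp add: coord vec_eq_iff)
  with ex show "\<exists>!w. f = pairing w"
    by blast
next
  assume "\<exists>!w. f = pairing w"
  then obtain w where f: "f = pairing w" by blast
  have "vector_space ((*) :: 'a \<Rightarrow> 'a \<Rightarrow> 'a)"
    by unfold_locales (simp_all add: algebra_simps)
  then show "Vector_Spaces.linear (*s) (*) f"
    unfolding f Vector_Spaces.linear_iff
    by (auto simp: vec.vector_space_axioms pairing_def algebra_simps sum.distrib sum_distrib_left)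
qed

definition proj_ker :: "('a::field, 'n::finite) proj \<Rightarrow> ('a, 'n) proj set" where
  "proj_ker \<xi> = {proj_of x | x. x \<noteq> 0 \<and> (\<forall>w\<in>line_of \<xi>. pairing w x = 0)}"

definition dual_complement :: "('a::field, 'n::finite) proj set \<Rightarrow> ('a, 'n) proj set" where
  "dual_complement E = {\<xi>. proj_ker \<xi> \<inter> E = {}}"

definition projective_line :: "('a::field, 'n::finite) proj set \<Rightarrow> bool" where
  "projective_line l \<longleftrightarrow>
     (\<exists>S. vec.subspace S \<and> vec.dim S = 2 \<and> l = proj_of ` (S - {0}))"

definition projective_hyperplane :: "('a::field, 'n::finite) proj set \<Rightarrow> bool" where
  "projective_hyperplane H \<longleftrightarrow> (\<exists>\<xi>. H = proj_ker \<xi>)"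

definition affine_line :: "('a::field, 'n::finite) proj set \<Rightarrow> bool" where
  "affine_line A \<longleftrightarrow> (\<exists>l p. projective_line l \<and> p \<in> l \<and> A = l - {p})"

definition proj_convex :: "(real, 'n::finite) proj set \<Rightarrow> bool" where
  "proj_convex E \<longleftrightarrow>
     (\<forall>l. projective_line l \<longrightarrow> \<not> l \<subseteq> E \<and> connected (E \<inter> l))"

definition properly_convex :: "(real, 'n::finite) proj set \<Rightarrow> bool" where
  "properly_convex E \<longleftrightarrow> proj_convex E \<and>
     (\<forall>H. projective_hyperplane H \<longrightarrow> \<not> E \<subseteq> H) \<and>
     (\<forall>A. affine_line A \<longrightarrow> \<not> A \<subseteq> E)"

definition complexify :: "real ^ 'n \<Rightarrow> complex ^ 'n" where
  "complexify v = (\<chi> i. complex_of_real (v $ i))"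

text \<open>
  For nonzero \<open>v0\<close>, \<open>v1\<close>, the sets \<open>I\<close> and \<open>I^e\<close>. If \<open>v0\<close>, \<open>v1\<close> are linearly independent, this
  is one of the two segments with endpoints \<open>proj_of v0\<close>, \<open>proj_of v1\<close> (the other one is
  obtained from \<open>v0\<close>, \<open>- v1\<close>); otherwise \<open>I\<close> and \<open>I^e\<close> are the single point \<open>proj_of v0\<close>.
\<close>

definition proj_segment :: "real ^ 'n \<Rightarrow> real ^ 'n \<Rightarrow> (real, 'n::finite) proj set" where
  "proj_segment v0 v1 =
     proj_of ` {c0 *s v0 + c1 *s v1 | c0 c1.
       c0 * c1 \<ge> 0 \<and> c0 *s v0 + c1 *s v1 \<noteq> 0}"

definition elliptic_segment :: "real ^ 'n \<Rightarrow> real ^ 'n \<Rightarrow> (complex, 'n::finite) proj set" where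
  "elliptic_segment v0 v1 =
     proj_of ` {c0 *s complexify v0 + c1 *s complexify v1 | c0 c1.
       Re (c0 * cnj c1) \<ge> 0 \<and> c0 *s complexify v0 + c1 *s complexify v1 \<noteq> 0}"

definition elliptic_tube :: "(real, 'n::finite) proj set \<Rightarrow> (complex, 'n) proj set" where
  "elliptic_tube D =
     \<Union> {elliptic_segment v0 v1 | v0 v1. v0 \<noteq> 0 \<and> v1 \<noteq> 0 \<and> proj_segment v0 v1 \<subseteq> D}"

end

theory Submission
  imports Defs
begin

text \<open>
  Let \<open>G\<close> be the set of nonzero vectors over \<open>D\<close>. Choosing the phase of the coefficients suitably, the
  points of \<open>D^e\<close> are exactly the \<open>\<pi>(x + iy)\<close> such that all nontrivial nonnegative
  combinations of \<open>x\<close> and \<open>y\<close> lie in \<open>G\<close>; likewise for \<open>D^*\<close>.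
  If \<open>u + iw\<close> is over \<open>(D^*)^e\<close> and \<open>x + iy\<close> over \<open>D^e\<close>, then \<open>u(x), u(y), w(x), w(y)\<close> have
  the same strict sign, so the imaginary part \<open>u(y) + w(x)\<close> of the pairing is nonzero.

  Conversely, let \<open>\<zeta>\<close> be over \<open>(D^e)^*\<close>. If \<open>x\<close> and \<open>y\<close> span a segment in \<open>D\<close>, then \<open>\<zeta>(x)\<close> and
  \<open>\<zeta>(y)\<close> are never orthogonal along it, so they make an acute angle. By convexity, \<open>\<zeta>(G)\<close> thus
  lies in a double sector of the complex plane, any two of whose lines make an angle less than a
  right angle. The opening of the sector is therefore at most a right angle, and since \<open>D\<close> is open
  or compact, the two extreme angles are both attained or both not attained. So a rotation moves
  \<open>\<zeta>(G)\<close> into the union of the open first and third quadrants, where real and imaginary part of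
  \<open>\<zeta>\<close> span a segment in \<open>D^*\<close>.
\<close>

section \<open>Lifts to the vector space and positive cones\<close>

definition lift :: "('a::field, 'n::finite) proj set \<Rightarrow> ('a ^ 'n) set" where
  "lift E = {v. v \<noteq> 0 \<and> proj_of v \<in> E}"

definition pos_cone :: "'v::real_vector \<Rightarrow> 'v \<Rightarrow> 'v set" where
  "pos_cone x y = {a *\<^sub>R x + b *\<^sub>R y | a b. a \<ge> 0 \<and> b \<ge> 0 \<and> (a > 0 \<or> b > 0)}"

lemma pos_coneI: "a \<ge> 0 \<Longrightarrow> b \<ge> 0 \<Longrightarrow> a > 0 \<or> b > 0 \<Longrightarrow> a *\<^sub>R x + b *\<^sub>R y \<in> pos_cone x y"
  unfolding pos_cone_def by blast

lemma pos_cone_left: "x \<in> pos_cone x y"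
  using pos_coneI[of 1 0 x y] by simp

lemma pos_cone_right: "y \<in> pos_cone x y"
  using pos_coneI[of 0 1 x y] by simp

lemma pos_cone_subset:
  assumes "x' \<in> pos_cone x y" "y' \<in> pos_cone x y"
  shows "pos_cone x' y' \<subseteq> pos_cone x y"
proof
  fix v assume "v \<in> pos_cone x' y'"
  then obtain a b where v: "v = a *\<^sub>R x' + b *\<^sub>R y'" "a \<ge> 0" "b \<ge> 0" "a > 0 \<or> b > 0"
    unfolding pos_cone_def by blast
  obtain c d where x': "x' = c *\<^sub>R x + d *\<^sub>R y" "c \<ge> 0" "d \<ge> 0" "c > 0 \<or> d > 0"
    using assms(1) unfolding pos_cone_def by blast
  obtain e f where y': "y' = e *\<^sub>R x + f *\<^sub>R y" "e \<ge> 0" "f \<ge> 0" "e > 0 \<or> f > 0"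
    using assms(2) unfolding pos_cone_def by blast
  have "v = (a * c + b * e) *\<^sub>R x + (a * d + b * f) *\<^sub>R y"
    unfolding v x' y' by (simp add: algebra_simps)
  moreover have "a * c + b * e > 0 \<or> a * d + b * f > 0"
    using v x' y' by (smt (verit) mult_nonneg_nonneg mult_pos_pos)
  moreover have "a * c + b * e \<ge> 0" "a * d + b * f \<ge> 0"
    using v x' y' by simp_all
  ultimately show "v \<in> pos_cone x y"
    using pos_coneI by metis
qed

lemma pos_cone_scale_right: "c > 0 \<Longrightarrow> c *\<^sub>R y \<in> pos_cone x y"
  using pos_coneI[of 0 c x y] by simp

section \<open>Points, pairing and dual complement in homogeneous coordinates\<close>

lemma proj_of_eq_iff:
  fixes v w :: "'a::field ^ 'n::finite"
  assumes "v \<noteq> 0" "w \<noteq> 0"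
  shows "proj_of v = proj_of w \<longleftrightarrow> (\<exists>c. c \<noteq> 0 \<and> v = c *s w)"
proof -
  have "proj_of v = proj_of w \<longleftrightarrow> vec.span {v} = vec.span {w}"
    using assms line_of_proj_of line_of_inject by metis
  also have "\<dots> \<longleftrightarrow> (\<exists>c. c \<noteq> 0 \<and> v = c *s w)"
  proof
    assume "vec.span {v} = vec.span {w}"
    then have "v \<in> vec.span {w}" using vec.span_base by blast
    then obtain c where "v = c *s w" by (auto simp: vec.span_singleton)
    with assms show "\<exists>c. c \<noteq> 0 \<and> v = c *s w" by auto
  next
    assume "\<exists>c. c \<noteq> 0 \<and> v = c *s w"
    then obtain c where c: "c \<noteq> 0" "v = c *s w" by blast
    then have "w = inverse c *s v" by (simp add: vec.scale_scale)
    then have "w \<in> vec.span {v}" using vec.span_scale vec.span_base by blast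
    moreover have "v \<in> vec.span {w}" using c vec.span_scale vec.span_base by blast
    ultimately show "vec.span {v} = vec.span {w}"
      by (simp add: vec.span_eq)
  qed
  finally show ?thesis .
qed

lemma proj_of_scale:
  fixes v :: "'a::field ^ 'n::finite"
  assumes "c \<noteq> 0" "v \<noteq> 0"
  shows "proj_of (c *s v) = proj_of v"
  using assms by (subst proj_of_eq_iff) auto

lemma proj_of_surj: "\<exists>v. v \<noteq> 0 \<and> P = proj_of v"
  using line_of[of P] line_of_inverse[of P] unfolding proj_of_def by auto

lemma lift_scale: "c \<noteq> 0 \<Longrightarrow> v \<in> lift E \<Longrightarrow> c *s v \<in> lift E"
  by (auto simp: lift_def proj_of_scale)

lemma lift_scaleR:
  fixes v :: "real ^ 'n::finite"
  shows "c \<noteq> 0 \<Longrightarrow> v \<in> lift E \<Longrightarrow> c *\<^sub>R v \<in> lift E"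
  using lift_scale[of c v E] by (simp add: scalar_mult_eq_scaleR)

lemma pairing_add_left: "pairing (u + v) x = pairing u x + pairing v x"
  and pairing_add_right: "pairing x (u + v) = pairing x u + pairing x v"
  and pairing_scale_left: "pairing (c *s u) x = c * pairing u x"
  and pairing_scale_right: "pairing x (c *s u) = c * pairing x u"
  by (simp_all add: pairing_def algebra_simps sum.distrib sum_distrib_left)

lemma mem_dual_complement_iff:
  fixes w :: "'a::field ^ 'n::finite"
  assumes "w \<noteq> 0"
  shows "proj_of w \<in> dual_complement E \<longleftrightarrow> (\<forall>x\<in>lift E. pairing w x \<noteq> 0)"
proof -
  have "(\<forall>u\<in>line_of (proj_of w). pairing u x = 0) \<longleftrightarrow> pairing w x = 0" for x
    using assms by (auto simp: line_of_proj_of vec.span_singleton pairing_scale_left)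
  then show ?thesis
    unfolding dual_complement_def proj_ker_def lift_def by auto
qed

section \<open>Complex vectors as pairs of real vectors\<close>

definition cvec :: "real ^ 'n \<Rightarrow> real ^ 'n \<Rightarrow> complex ^ 'n::finite" where
  "cvec x y = complexify x + \<i> *s complexify y"

lemma cvec_nth: "cvec x y $ i = Complex (x $ i) (y $ i)"
  by (simp add: cvec_def complexify_def complex_eq_iff)

lemma cvec_surj: "z = cvec (\<chi> i. Re (z $ i)) (\<chi> i. Im (z $ i))"
  by (simp add: vec_eq_iff cvec_nth)

lemma cvec_eq_0_iff: "cvec x y = 0 \<longleftrightarrow> x = 0 \<and> y = 0"
  by (auto simp: vec_eq_iff cvec_nth complex_eq_iff)

lemma pairing_complexify:
  "pairing (cvec u w) (complexify x) = Complex (pairing u x) (pairing w x)"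
  by (simp add: pairing_def cvec_nth complexify_def complex_eq_iff)

lemma pairing_cvec:
  "pairing z (cvec x y) = pairing z (complexify x) + \<i> * pairing z (complexify y)"
  by (simp add: cvec_def pairing_add_right pairing_scale_right)

lemma linear_pairing_complexify:
  fixes z :: "complex ^ 'n::finite"
  shows "linear (\<lambda>x. pairing z (complexify x))"
proof (rule linearI)
  fix x y :: "real ^ 'n" and c :: real
  have "complexify (x + y) = complexify x + complexify y"
    "complexify (c *\<^sub>R x) = of_real c *s complexify x"
    by (simp_all add: complexify_def vec_eq_iff)
  then show "pairing z (complexify (x + y)) = pairing z (complexify x) + pairing z (complexify y)"
    "pairing z (complexify (c *\<^sub>R x)) = c *\<^sub>R pairing z (complexify x)"
    by (simp_all add: pairing_add_right pairing_scale_right scaleR_conv_of_real)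
qed

section \<open>Elliptic tubes described by positive cones\<close>

text \<open>Nonzero coefficients make at most a right angle. Turning the clockwise one onto the
  positive real axis puts the other into the closed first quadrant. If they are parallel or one is
  zero, both would end up real, so \<open>1 + \<i>\<close> turns them by a further
  \<open>pi / 4\<close>.\<close>

lemma rotate_into_quadrant:
  fixes c0 c1 :: complex
  assumes "Re (c0 * cnj c1) \<ge> 0" "c0 \<noteq> 0 \<or> c1 \<noteq> 0"
  obtains l where "l \<noteq> 0" "Re (l * c0) \<ge> 0" "Re (l * c1) \<ge> 0" "Im (l * c0) \<ge> 0" "Im (l * c1) \<ge> 0"
    "Re (l * c0) > 0 \<or> Re (l * c1) > 0" "Im (l * c0) > 0 \<or> Im (l * c1) > 0"
proof -
  let ?P = "\<lambda>c0 c1 l. l \<noteq> 0 \<and> Re (l * c0) \<ge> 0 \<and> Re (l * c1) \<ge> 0 \<and> Im (l * c0) \<ge> 0 \<and> Im (l * c1) \<ge> 0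
    \<and> (Re (l * c0) > 0 \<or> Re (l * c1) > 0) \<and> (Im (l * c0) > 0 \<or> Im (l * c1) > 0)"
  have *: "\<exists>l. ?P c0 c1 l" if h: "Re (c0 * cnj c1) \<ge> 0" "c0 \<noteq> 0" "Im (c0 * cnj c1) \<le> 0"
    for c0 c1 :: complex
  proof (cases "Im (c0 * cnj c1) = 0")
    case True
    have "(Re c0)\<^sup>2 + (Im c0)\<^sup>2 > 0" using h by (simp add: complex_neq_0)
    then have "?P c0 c1 ((1 + \<i>) * cnj c0)"
      using True h by (auto simp: algebra_simps power2_eq_square complex_eq_iff)
    then show ?thesis by blast
  next
    case False
    have "(Re c0)\<^sup>2 + (Im c0)\<^sup>2 > 0" using h by (simp add: complex_neq_0)
    then have "?P c0 c1 (cnj c0)"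
      using False h by (auto simp: algebra_simps power2_eq_square)
    then show ?thesis by blast
  qed
  have "\<exists>l. ?P c0 c1 l"
  proof (cases "c0 \<noteq> 0 \<and> Im (c0 * cnj c1) \<le> 0")
    case True
    then show ?thesis using * assms by blast
  next
    case False
    have "\<exists>l. ?P c1 c0 l"
      by (rule *) (use False assms in \<open>auto simp: algebra_simps\<close>)
    then show ?thesis by blast
  qed
  then show ?thesis using that by blast
qed

lemma pos_cone_subset_lift_if_segment:
  fixes x y :: "real ^ 'n::finite"
  assumes "proj_segment v0 v1 \<subseteq> E" "x \<in> pos_cone v0 v1" "y \<in> pos_cone v0 v1" "0 \<notin> pos_cone v0 v1"
  shows "pos_cone x y \<subseteq> lift E"
proof -
  have "pos_cone v0 v1 \<subseteq> lift E"
  proof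
    fix v assume v: "v \<in> pos_cone v0 v1"
    with assms(4) have "v \<noteq> 0" by blast
    from v obtain a b where "v = a *s v0 + b *s v1" "a \<ge> 0" "b \<ge> 0"
      unfolding pos_cone_def scalar_mult_eq_scaleR by blast
    with \<open>v \<noteq> 0\<close> have "proj_of v \<in> proj_segment v0 v1"
      unfolding proj_segment_def by (intro imageI CollectI exI[of _ a] exI[of _ b]) auto
    with \<open>v \<noteq> 0\<close> assms(1) show "v \<in> lift E" by (auto simp: lift_def)
  qed
  with pos_cone_subset[OF assms(2,3)] show ?thesis by blast
qed

text \<open>After multiplication by a common factor both coefficients lie in the closed first
  quadrant, so the real and imaginary parts of the vector lie in the cone over the endpoints of the
  segment.\<close>

lemma elliptic_tube_eq:
  fixes E :: "(real, 'n::finite) proj set"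
  shows "elliptic_tube E = {proj_of (cvec x y) | x y. pos_cone x y \<subseteq> lift E}"
proof (intro equalityI subsetI)
  fix P assume "P \<in> elliptic_tube E"
  then obtain v0 v1 c0 c1 where v: "v0 \<noteq> 0" "v1 \<noteq> 0" "proj_segment v0 v1 \<subseteq> E"
    and c: "Re (c0 * cnj c1) \<ge> 0"
    and P: "P = proj_of (c0 *s complexify v0 + c1 *s complexify v1)"
    and nz: "c0 *s complexify v0 + c1 *s complexify v1 \<noteq> 0"
    unfolding elliptic_tube_def elliptic_segment_def by blast
  show "P \<in> {proj_of (cvec x y) | x y. pos_cone x y \<subseteq> lift E}"
  proof (cases "\<exists>k. v1 = k *\<^sub>R v0")
    \<comment> \<open>Dependent endpoints are treated apart, since the cone over \<open>v0\<close>
      and \<open>- v0\<close> contains \<open>0\<close>. The segment is a single point here, and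
      \<open>cvec v0 v0\<close> is \<open>1 + \<i>\<close> times its real representative.\<close>
    case True
    then obtain k where k: "v1 = k *\<^sub>R v0" by blast
    have "1 + \<i> \<noteq> 0" by (simp add: complex_eq_iff)
    then have eq: "c0 *s complexify v0 + c1 *s complexify v1 = ((c0 + c1 * of_real k) / (1 + \<i>)) *s cvec v0 v0"
      by (simp add: k vec_eq_iff cvec_def complexify_def divide_simps algebra_simps)
    then have "P = proj_of (cvec v0 v0)"
      using nz unfolding P by (subst proj_of_eq_iff) (auto simp: cvec_eq_0_iff v)
    moreover have "proj_of v0 \<in> proj_segment v0 v1"
      unfolding proj_segment_def using v by (intro imageI CollectI exI[of _ 1] exI[of _ 0]) auto
    then have "v0 \<in> lift E" using v by (auto simp: lift_def)
    then have "pos_cone v0 v0 \<subseteq> lift E"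
      by (auto simp: pos_cone_def scaleR_add_left[symmetric] intro!: lift_scaleR)
    ultimately show ?thesis by blast
  next
    case False
    have ind: "0 \<notin> pos_cone v0 v1"
    proof
      assume "0 \<in> pos_cone v0 v1"
      then obtain a b where ab: "a *\<^sub>R v0 + b *\<^sub>R v1 = 0" "a > 0 \<or> b > 0"
        unfolding pos_cone_def by force
      show False
      proof (cases "b = 0")
        case True with ab v show False by auto
      next
        case b: False
        then have "v1 = inverse b *\<^sub>R (b *\<^sub>R v1)" by simp
        also have "b *\<^sub>R v1 = (- a) *\<^sub>R v0" using ab by (simp add: eq_neg_iff_add_eq_0 add.commute)
        finally show False using False by (metis scaleR_scaleR)
      qed
    qed
    from nz have "c0 \<noteq> 0 \<or> c1 \<noteq> 0" by auto
    from rotate_into_quadrant[OF c this] obtain l where l: "l \<noteq> 0" "Re (l * c0) \<ge> 0" "Re (l * c1) \<ge> 0"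
        "Im (l * c0) \<ge> 0" "Im (l * c1) \<ge> 0"
        "Re (l * c0) > 0 \<or> Re (l * c1) > 0" "Im (l * c0) > 0 \<or> Im (l * c1) > 0"
      by metis
    define x where "x = Re (l * c0) *\<^sub>R v0 + Re (l * c1) *\<^sub>R v1"
    define y where "y = Im (l * c0) *\<^sub>R v0 + Im (l * c1) *\<^sub>R v1"
    have xy: "x \<in> pos_cone v0 v1" "y \<in> pos_cone v0 v1"
      unfolding x_def y_def by (intro pos_coneI l)+
    have "l *s (c0 *s complexify v0 + c1 *s complexify v1) = cvec x y"
      by (simp add: vec_eq_iff cvec_nth complexify_def x_def y_def complex_eq_iff algebra_simps)
    then have "P = proj_of (cvec x y)"
      unfolding P using proj_of_scale[OF l(1) nz] by simp
    with pos_cone_subset_lift_if_segment[OF v(3) xy ind] show ?thesis by blast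
  qed
next
  fix P assume "P \<in> {proj_of (cvec x y) | x y. pos_cone x y \<subseteq> lift E}"
  then obtain x y where P: "P = proj_of (cvec x y)" and xy: "pos_cone x y \<subseteq> lift E" by blast
  have nz: "x \<noteq> 0" "y \<noteq> 0"
    using xy pos_cone_left[of x y] pos_cone_right[of y x] by (auto simp: lift_def)
  have "proj_segment x y \<subseteq> E"
  proof
    fix Q assume "Q \<in> proj_segment x y"
    then obtain a b where ab: "a * b \<ge> 0" "a *\<^sub>R x + b *\<^sub>R y \<noteq> 0" "Q = proj_of (a *\<^sub>R x + b *\<^sub>R y)"
      unfolding proj_segment_def scalar_mult_eq_scaleR by blast
    have "a *\<^sub>R x + b *\<^sub>R y \<in> lift E"
    proof (cases "a \<ge> 0 \<and> b \<ge> 0")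
      case True
      with ab(2) have "a > 0 \<or> b > 0" by (auto simp: less_le)
      with True have "a *\<^sub>R x + b *\<^sub>R y \<in> pos_cone x y" by (intro pos_coneI) auto
      with xy show ?thesis by blast
    next
      case False
      with ab have "- a \<ge> 0" "- b \<ge> 0" "- a > 0 \<or> - b > 0"
        by (auto simp: zero_le_mult_iff)
      with xy pos_coneI have "(- a) *\<^sub>R x + (- b) *\<^sub>R y \<in> lift E" by blast
      from lift_scaleR[OF _ this, of "-1"] show ?thesis by (simp add: add.commute)
    qed
    with ab show "Q \<in> E" by (simp add: lift_def)
  qed
  \<comment> \<open>The coefficients \<open>1\<close> and \<open>\<i>\<close> are orthogonal, the
    boundary case of the condition on \<open>Re (c0 * cnj c1)\<close>.\<close>
  moreover have "P \<in> elliptic_segment x y"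
    unfolding elliptic_segment_def P
    by (intro imageI CollectI exI[of _ 1] exI[of _ \<i>])
      (use cvec_eq_0_iff[of x y] nz in \<open>auto simp: cvec_def\<close>)
  ultimately show "P \<in> elliptic_tube E"
    unfolding elliptic_tube_def using nz by blast
qed

section \<open>The tube of the dual lies in the dual of the tube\<close>

text \<open>With opposite signs at \<open>x\<close> and \<open>y\<close>, the combination with
  weights \<open>\<bar>f y\<bar>\<close> and \<open>\<bar>f x\<bar>\<close> would be a zero of
  \<open>f\<close> in the cone.\<close>

lemma same_sign_on_pos_cone:
  fixes f :: "'v::real_vector \<Rightarrow> real"
  assumes "linear f" "\<And>v. v \<in> pos_cone x y \<Longrightarrow> f v \<noteq> 0"
  shows "f x * f y > 0"
proof (rule ccontr)
  assume "\<not> f x * f y > 0"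
  moreover have "f x \<noteq> 0" "f y \<noteq> 0" using assms(2) pos_cone_left pos_cone_right by blast+
  ultimately have "f x * f y < 0" by (simp add: not_less less_le)
  have "\<bar>f y\<bar> *\<^sub>R x + \<bar>f x\<bar> *\<^sub>R y \<in> pos_cone x y"
    using \<open>f x \<noteq> 0\<close> by (intro pos_coneI) auto
  from assms(2)[OF this] show False
    using \<open>f x * f y < 0\<close> assms(1)
    by (auto simp: linear_add linear_scale abs_if mult_less_0_iff split: if_splits)
qed

lemma linear_pairing_real: "linear (pairing u :: real ^ 'n::finite \<Rightarrow> real)"
  "linear (\<lambda>u :: real ^ 'n::finite. pairing u x)"
  by (auto intro!: linearI simp: pairing_add_right pairing_add_left
      scalar_mult_eq_scaleR[symmetric] pairing_scale_right pairing_scale_left)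

lemma tube_of_dual_subset:
  fixes E :: "(real, 'n::finite) proj set"
  shows "elliptic_tube (dual_complement E) \<subseteq> dual_complement (elliptic_tube E)"
proof
  fix P assume "P \<in> elliptic_tube (dual_complement E)"
  then obtain u w where P: "P = proj_of (cvec u w)" and uw: "pos_cone u w \<subseteq> lift (dual_complement E)"
    unfolding elliptic_tube_eq by blast
  have pos: "pairing u' x' \<noteq> 0" if "u' \<in> pos_cone u w" "x' \<in> lift E" for u' x'
    using uw that mem_dual_complement_iff[of u' E] by (auto simp: lift_def)
  have "u \<noteq> 0" using uw pos_cone_left[of u w] by (auto simp: lift_def)
  then have nz: "cvec u w \<noteq> 0" by (simp add: cvec_eq_0_iff)
  have "pairing (cvec u w) z \<noteq> 0" if "z \<in> lift (elliptic_tube E)" for z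
  proof -
    from that obtain x y where z: "z \<noteq> 0" "proj_of z = proj_of (cvec x y)" and xy: "pos_cone x y \<subseteq> lift E"
      unfolding elliptic_tube_eq lift_def by blast
    have xE: "x \<in> lift E" "y \<in> lift E" using xy pos_cone_left[of x y] pos_cone_right[of y x] by auto
    then have "cvec x y \<noteq> 0" by (auto simp: lift_def cvec_eq_0_iff)
    with z obtain c where c: "c \<noteq> 0" "z = c *s cvec x y" by (auto simp: proj_of_eq_iff)
    \<comment> \<open>One argument is fixed while the other runs through a cone on which the pairing
      has no zero. Chained together, the three products give all four numbers one sign.\<close>
    have "pairing u x * pairing u y > 0" "pairing w x * pairing w y > 0"
      by (rule same_sign_on_pos_cone[OF linear_pairing_real(1)];
          use pos xy pos_cone_left[of u w] pos_cone_right[of w u] in blast)+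
    moreover have "pairing u x * pairing w x > 0"
      by (rule same_sign_on_pos_cone[OF linear_pairing_real(2)[of x]]) (use pos xE in blast)
    ultimately have "pairing u y + pairing w x \<noteq> 0"
      by (smt (verit) zero_less_mult_iff)
    then have "pairing (cvec u w) (cvec x y) \<noteq> 0"
      by (simp add: pairing_cvec pairing_complexify complex_eq_iff add.commute)
    then show ?thesis using c by (simp add: pairing_scale_right)
  qed
  then show "P \<in> dual_complement (elliptic_tube E)"
    unfolding P mem_dual_complement_iff[OF nz] by blast
qed

section \<open>Open sets of projective space and convexity along a line\<close>

lemma open_lift: "open E \<Longrightarrow> open (lift E)"
  unfolding lift_def open_proj_def .

text \<open>A scaling-invariant \<open>W\<close> is saturated for the projection. Homogeneous
  conditions on vectors can thus be used to define open sets of points.\<close>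

lemma lift_image:
  assumes "\<And>c v. c \<noteq> 0 \<Longrightarrow> v \<in> W \<Longrightarrow> c *s v \<in> W"
  shows "lift (proj_of ` (W - {0})) = W - {0}"
proof (intro equalityI subsetI)
  fix v assume "v \<in> lift (proj_of ` (W - {0}))"
  then obtain w where "v \<noteq> 0" "w \<noteq> 0" "w \<in> W" "proj_of v = proj_of w" by (auto simp: lift_def)
  then show "v \<in> W - {0}" using assms by (auto simp: proj_of_eq_iff)
qed (auto simp: lift_def)

lemma open_proj_image:
  fixes W :: "('a::real_normed_field ^ 'n::finite) set"
  assumes "open W" "\<And>c v. c \<noteq> 0 \<Longrightarrow> v \<in> W \<Longrightarrow> c *s v \<in> W"
  shows "open (proj_of ` (W - {0}))"
proof -
  have "lift (proj_of ` (W - {0})) = W - {0}"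
    using assms(2) by (rule lift_image)
  then have "open (lift (proj_of ` (W - {0})))"
    using assms(1) by (simp add: open_delete)
  then show ?thesis unfolding lift_def open_proj_def .
qed


lemma linear_continuous_real:
  fixes f :: "real ^ 'n::finite \<Rightarrow> 'b::real_normed_vector"
  shows "linear f \<Longrightarrow> continuous_on S f"
  by (simp add: linear_continuous_on linear_conv_bounded_linear)

text \<open>The two cones lie over the two segments joining the points of \<open>x\<close> and
  \<open>y\<close>. If each segment missed a point of \<open>E\<close>, these two missing points
  would disconnect the intersection of \<open>E\<close> with the projective line.\<close>

lemma proj_convex_pos_cone:
  fixes E :: "(real, 'n::finite) proj set"
  assumes conv: "proj_convex E" and x: "x \<in> lift E" and y: "y \<in> lift E"
  shows "pos_cone x y \<subseteq> lift E \<or> pos_cone x (- y) \<subseteq> lift E"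
proof (rule ccontr)
  assume "\<not> ?thesis"
  then obtain v v' where v: "v \<in> pos_cone x y" "v \<notin> lift E" and v': "v' \<in> pos_cone x (- y)" "v' \<notin> lift E"
    by blast
  obtain a b where ab: "v = a *\<^sub>R x + b *\<^sub>R y" "a \<ge> 0" "b \<ge> 0" "a > 0 \<or> b > 0"
    using v(1) unfolding pos_cone_def by blast
  obtain c d where cd: "v' = c *\<^sub>R x - d *\<^sub>R y" "c \<ge> 0" "d \<ge> 0" "c > 0 \<or> d > 0"
    using v'(1) unfolding pos_cone_def by auto
  have nz: "x \<noteq> 0" "y \<noteq> 0" using x y by (auto simp: lift_def)
  have "a \<noteq> 0" "b \<noteq> 0" using lift_scaleR[of b y E] lift_scaleR[of a x E] v(2) ab x y by auto
  with ab have pos: "a > 0" "b > 0" by auto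
  have "c \<noteq> 0" "d \<noteq> 0" using lift_scaleR[of "-d" y E] lift_scaleR[of c x E] v'(2) cd x y by auto
  with cd have pos': "c > 0" "d > 0" by auto
  \<comment> \<open>If \<open>y\<close> were a multiple of \<open>x\<close>, then \<open>v\<close>
    and \<open>v'\<close>, being outside the lift, would both be zero, which forces contradictory
    signs on \<open>k\<close>.\<close>
  have indep: "y \<noteq> k *\<^sub>R x" for k
  proof
    assume k: "y = k *\<^sub>R x"
    have "v = (a + b * k) *\<^sub>R x" "v' = (c - d * k) *\<^sub>R x"
      unfolding ab cd k by (simp_all add: algebra_simps)
    then have "a + b * k = 0" "c - d * k = 0" using v(2) v'(2) lift_scaleR x by blast+
    then have "b * k < 0" "d * k > 0" using pos pos' by linarith+
    with pos pos' show False by (simp add: zero_less_mult_iff mult_less_0_iff)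
  qed
  define \<Delta> where "\<Delta> = (x \<bullet> x) * (y \<bullet> y) - (x \<bullet> y)\<^sup>2"
  have "\<Delta> \<noteq> 0"
  proof
    assume "\<Delta> = 0"
    have "(x \<bullet> x) *\<^sub>R y = (x \<bullet> y) *\<^sub>R x"
    proof -
      have "((x \<bullet> x) *\<^sub>R y - (x \<bullet> y) *\<^sub>R x) \<bullet> ((x \<bullet> x) *\<^sub>R y - (x \<bullet> y) *\<^sub>R x) = (x \<bullet> x) * \<Delta>"
        by (simp add: \<Delta>_def inner_diff_left inner_diff_right power2_eq_square algebra_simps inner_commute)
      with \<open>\<Delta> = 0\<close> show ?thesis by simp
    qed
    then have "y = ((x \<bullet> y) / (x \<bullet> x)) *\<^sub>R x"
      using nz by (metis inner_eq_zero_iff real_vector.scale_left_imp_eq scaleR_scaleR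
          nonzero_eq_divide_eq mult.commute)
    with indep show False by blast
  qed
  \<comment> \<open>coordinates on the span of \<open>x\<close> and \<open>y\<close>, scaled by the Gram determinant \<open>\<Delta>\<close>\<close>
  define \<alpha> where "\<alpha> = (\<lambda>u. (u \<bullet> x) * (y \<bullet> y) - (u \<bullet> y) * (x \<bullet> y))"
  define \<beta> where "\<beta> = (\<lambda>u. (u \<bullet> y) * (x \<bullet> x) - (u \<bullet> x) * (x \<bullet> y))"
  have \<alpha>: "\<alpha> (s *\<^sub>R x + t *\<^sub>R y) = s * \<Delta>" and \<beta>: "\<beta> (s *\<^sub>R x + t *\<^sub>R y) = t * \<Delta>" for s t
    by (simp_all add: \<alpha>_def \<beta>_def \<Delta>_def inner_add_left inner_commute power2_eq_square algebra_simps)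
  have sc: "\<alpha> (k *s u) = k * \<alpha> u" "\<beta> (k *s u) = k * \<beta> u" for k u
    by (simp_all add: \<alpha>_def \<beta>_def scalar_mult_eq_scaleR algebra_simps)
  \<comment> \<open>On the span of \<open>x\<close> and \<open>y\<close>, the first factor vanishes
    exactly on the line of \<open>v\<close> and the second exactly on that of \<open>v'\<close>.
    Being homogeneous of degree 2, \<open>q\<close> has a well-defined sign at each point, and this
    sign separates \<open>x\<close> from \<open>y\<close>.\<close>
  define q where "q = (\<lambda>u. (b * \<alpha> u - a * \<beta> u) * (d * \<alpha> u + c * \<beta> u))"
  have q_sc: "q (k *s u) = k\<^sup>2 * q u" for k u
    by (simp add: q_def sc power2_eq_square algebra_simps)
  have q: "q (s *\<^sub>R x + t *\<^sub>R y) = \<Delta>\<^sup>2 * ((b * s - a * t) * (d * s + c * t))" for s t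
    by (simp add: q_def \<alpha> \<beta> power2_eq_square algebra_simps)
  have q_cont: "continuous_on UNIV q"
    unfolding q_def \<alpha>_def \<beta>_def by (intro continuous_intros)
  let ?S = "vec.span {x, y}"
  let ?l = "proj_of ` (?S - {0})"
  have S: "u \<in> ?S \<longleftrightarrow> (\<exists>s t. u = s *\<^sub>R x + t *\<^sub>R y)" for u
    by (simp add: vec.span_insert vec.span_singleton image_iff diff_eq_eq add.commute)
      (simp add: scalar_mult_eq_scaleR)
  have "vec.independent {y, x}"
    using nz indep indep[of 1]
    by (simp add: vec.independent_insert vec.span_singleton image_iff)
      (simp add: scalar_mult_eq_scaleR)
  then have "vec.independent {x, y}" by (simp add: insert_commute)
  then have "vec.dim ?S = card {x, y}" by (rule vec.dim_span_eq_card_independent)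
  then have "vec.dim ?S = 2" using indep[of 1] by simp
  then have l: "projective_line ?l" unfolding projective_line_def by blast
  define U where "U = proj_of ` ({u. q u > 0} - {0})"
  define V where "V = proj_of ` ({u. q u < 0} - {0})"
  have U: "open U" "lift U = {u. q u > 0} - {0}" and V: "open V" "lift V = {u. q u < 0} - {0}"
    unfolding U_def V_def
    by (intro open_proj_image lift_image open_Collect_less continuous_intros q_cont;
        simp add: q_sc zero_less_mult_iff mult_less_0_iff)+
  have iff: "proj_of u \<in> X \<longleftrightarrow> u \<in> lift X" if "u \<noteq> 0" for u :: "real^'n" and X
    using that by (simp add: lift_def)
  have xy: "x \<in> ?S" "y \<in> ?S" by (simp_all add: vec.span_base)
  have "q x > 0" "q y < 0"
    using q[of 1 0] q[of 0 1] pos pos' \<open>\<Delta> \<noteq> 0\<close> by (simp_all add: mult_less_0_iff)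
  with xy x y nz have "proj_of x \<in> U \<inter> (E \<inter> ?l)" "proj_of y \<in> V \<inter> (E \<inter> ?l)"
    by (auto simp: iff U V)
  moreover have "U \<inter> V \<inter> (E \<inter> ?l) = {}"
  proof -
    have "lift U \<inter> lift V = {}" unfolding U V by auto
    then show ?thesis by (auto simp: iff)
  qed
  moreover have "E \<inter> ?l \<subseteq> U \<union> V"
  proof
    fix P assume "P \<in> E \<inter> ?l"
    then obtain u where u: "u \<noteq> 0" "u \<in> ?S" "P = proj_of u" "u \<in> lift E"
      unfolding lift_def by blast
    then obtain s t where st: "u = s *\<^sub>R x + t *\<^sub>R y" by (auto simp: S)
    have "q u \<noteq> 0"
    proof
      assume "q u = 0"
      then have "b * s = a * t \<or> d * s = - (c * t)" using \<open>\<Delta> \<noteq> 0\<close> by (auto simp: st q)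
      then have "u = (s / a) *\<^sub>R v \<or> u = (s / c) *\<^sub>R v'"
        using pos pos' by (auto simp: st ab cd algebra_simps nonzero_eq_divide_eq)
      moreover have "v \<noteq> 0" "v' \<noteq> 0"
        using \<alpha>[of a b] \<alpha>[of c "- d"] \<open>\<Delta> \<noteq> 0\<close> pos pos' unfolding ab cd by (auto simp: \<alpha>_def)
      ultimately show False
        using u v(2) v'(2) lift_scaleR[of "inverse (s/a)" u E] lift_scaleR[of "inverse (s/c)" u E] by auto
    qed
    then show "P \<in> U \<union> V" using u by (auto simp: iff U V)
  qed
  ultimately have "\<not> connected (E \<inter> ?l)"
    unfolding connected_def using U(1) V(1) by blast
  with conv l show False unfolding proj_convex_def by blast
qed

section \<open>Angles between the values of a functional\<close>

text \<open>If the angle were not acute, some \<open>p\<close> in the cone would have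
  \<open>\<zeta> p\<close> orthogonal to \<open>\<zeta> y\<close>, hence equal to
  \<open>\<i> * k * \<zeta> y\<close> with \<open>k\<close> real. A suitably ordered and scaled pair
  made of \<open>p\<close> and \<open>y\<close> then violates \<open>nz\<close>.\<close>

lemma Re_mult_cnj_pos_if_pos_cone:
  fixes \<zeta> :: "'v::real_vector \<Rightarrow> complex"
  assumes lin: "linear \<zeta>" and sub: "pos_cone x y \<subseteq> G"
    and nz: "\<And>x y. pos_cone x y \<subseteq> G \<Longrightarrow> \<zeta> x + \<i> * \<zeta> y \<noteq> 0"
  shows "Re (\<zeta> x * cnj (\<zeta> y)) > 0"
proof (rule ccontr)
  assume neg: "\<not> ?thesis"
  have nz1: "\<zeta> u \<noteq> 0" if "u \<in> pos_cone x y" for u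
    using nz[OF subset_trans[OF pos_cone_subset[OF that that] sub]] by auto
  define N where "N = (cmod (\<zeta> y))\<^sup>2"
  have N: "N > 0" using nz1[OF pos_cone_right] by (simp add: N_def)
  \<comment> \<open>The Gram-Schmidt coefficient; it is nonnegative because the angle is assumed not
    to be acute.\<close>
  define t where "t = - Re (\<zeta> x * cnj (\<zeta> y)) / N"
  define p where "p = x + t *\<^sub>R y"
  have "t \<ge> 0" using neg N by (simp add: t_def divide_nonpos_pos)
  then have p: "p \<in> pos_cone x y" unfolding p_def using pos_coneI[of 1 t x y] by simp
  define k where "k = Im (\<zeta> p * cnj (\<zeta> y)) / N"
  have \<zeta>p: "\<zeta> p = \<zeta> x + of_real t * \<zeta> y"
    unfolding p_def using lin by (simp add: linear_add linear_scale scaleR_conv_of_real)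
  have "\<zeta> p * cnj (\<zeta> y) = \<zeta> x * cnj (\<zeta> y) + of_real (t * N)"
    unfolding \<zeta>p N_def of_real_mult complex_norm_square by (simp add: algebra_simps)
  then have "Re (\<zeta> p * cnj (\<zeta> y)) = Re (\<zeta> x * cnj (\<zeta> y)) + t * N"
    by (simp only: plus_complex.sel Re_complex_of_real)
  then have "Re (\<zeta> p * cnj (\<zeta> y)) = 0" using N by (simp add: t_def)
  then have "\<zeta> p * cnj (\<zeta> y) = \<i> * of_real (k * N)"
    using N by (simp add: complex_eq_iff k_def)
  also have "\<dots> = \<i> * of_real k * (\<zeta> y * cnj (\<zeta> y))"
    by (simp add: N_def complex_norm_square[symmetric])
  finally have "(\<zeta> p - \<i> * of_real k * \<zeta> y) * cnj (\<zeta> y) = 0" by (simp add: algebra_simps)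
  then have eq: "\<zeta> p = \<i> * of_real k * \<zeta> y" using nz1[OF pos_cone_right] by simp
  with nz1[OF p] have "k \<noteq> 0" by auto
  then consider "k > 0" | "k < 0" by linarith
  then show False
  proof cases
    case 1
    have "pos_cone (k *\<^sub>R y) p \<subseteq> G"
      using pos_cone_subset[OF pos_cone_scale_right[OF 1] p] sub by blast
    from nz[OF this] show False
      unfolding eq using lin by (simp add: linear_scale scaleR_conv_of_real algebra_simps)
  next
    case 2
    then have "- k > 0" by simp
    have "pos_cone p ((- k) *\<^sub>R y) \<subseteq> G"
      using pos_cone_subset[OF p pos_cone_scale_right[OF \<open>- k > 0\<close>]] sub by blast
    from nz[OF this] show False
      unfolding eq using lin by (simp only: linear_scale) (simp add: scaleR_conv_of_real algebra_simps)
  qed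
qed

text \<open>Normalizing by \<open>\<zeta> x0\<close> keeps all values off the imaginary axis. Once
  each value is flipped to positive real part, any two make an acute angle. By convexity
  \<open>x\<close> spans a cone in \<open>G\<close> with \<open>y\<close> or with
  \<open>- y\<close>, and passing from \<open>y\<close> to \<open>- y\<close> changes the sign of
  two factors of the product.\<close>

lemma consistent_signs:
  fixes \<zeta> :: "'v::real_vector \<Rightarrow> complex"
  assumes lin: "linear \<zeta>" and x0: "x0 \<in> G"
    and conv: "\<And>x y. x \<in> G \<Longrightarrow> y \<in> G \<Longrightarrow> pos_cone x y \<subseteq> G \<or> pos_cone x (- y) \<subseteq> G"
    and nz: "\<And>x y. pos_cone x y \<subseteq> G \<Longrightarrow> \<zeta> x + \<i> * \<zeta> y \<noteq> 0"
  defines "\<eta> \<equiv> \<lambda>x. \<zeta> x * cnj (\<zeta> x0)"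
  shows "x \<in> G \<Longrightarrow> Re (\<eta> x) \<noteq> 0"
    and "x \<in> G \<Longrightarrow> y \<in> G \<Longrightarrow> Re (\<eta> x) * Re (\<eta> y) * Re (\<eta> x * cnj (\<eta> y)) > 0"
proof -
  note pos = Re_mult_cnj_pos_if_pos_cone[OF lin _ nz]
  have neg: "\<zeta> (- u) = - \<zeta> u" for u using lin by (rule linear_neg)
  show ne: "Re (\<eta> x) \<noteq> 0" if "x \<in> G" for x
    using conv[OF that x0] pos[of x x0] pos[of x "- x0"] by (auto simp: \<eta>_def neg)
  have lin': "linear (\<lambda>u. Re (\<eta> u))"
    using lin by (auto intro!: linearI simp: \<eta>_def linear_add linear_scale algebra_simps)
  have *: "Re (\<eta> x) * Re (\<eta> y) * Re (\<zeta> x * cnj (\<zeta> y)) > 0" if "pos_cone x y \<subseteq> G" for x y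
  proof (rule mult_pos_pos)
    show "Re (\<eta> x) * Re (\<eta> y) > 0"
      by (rule same_sign_on_pos_cone[OF lin']) (use ne that in blast)
    show "Re (\<zeta> x * cnj (\<zeta> y)) > 0" using that by (rule pos)
  qed
  have "\<eta> x * cnj (\<eta> y) = of_real ((cmod (\<zeta> x0))\<^sup>2) * (\<zeta> x * cnj (\<zeta> y))" for x y
    unfolding complex_norm_square \<eta>_def by (simp add: algebra_simps)
  then have eq: "Re (\<eta> x) * Re (\<eta> y) * Re (\<eta> x * cnj (\<eta> y))
      = (cmod (\<zeta> x0))\<^sup>2 * (Re (\<eta> x) * Re (\<eta> y) * Re (\<zeta> x * cnj (\<zeta> y)))" for x y
    by (simp add: Re_complex_of_real)
  have "\<zeta> x0 \<noteq> 0" using ne[OF x0] by (auto simp: \<eta>_def)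
  assume "x \<in> G" "y \<in> G"
  from conv[OF this] have "Re (\<eta> x) * Re (\<eta> y) * Re (\<zeta> x * cnj (\<zeta> y)) > 0"
  proof
    assume "pos_cone x (- y) \<subseteq> G"
    from *[OF this] have "Re (\<eta> x) * (- Re (\<eta> y)) * (- Re (\<zeta> x * cnj (\<zeta> y))) > 0"
      by (simp add: neg \<eta>_def)
    then show ?thesis by (simp only: mult_minus_left mult_minus_right minus_minus)
  qed (rule *)
  then show "Re (\<eta> x) * Re (\<eta> y) * Re (\<eta> x * cnj (\<eta> y)) > 0"
    unfolding eq using \<open>\<zeta> x0 \<noteq> 0\<close> by (intro mult_pos_pos[of "(cmod (\<zeta> x0))\<^sup>2"]) auto
qed

section \<open>Extremal ratios of linear functionals\<close>

text \<open>The ratio is scaling-invariant, so its strict sublevel sets come from open sets of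
  points. Without a maximum these would cover \<open>E\<close>, but the vector of largest ratio in a
  finite subcover is itself not covered.\<close>

lemma compact_attains_max_ratio:
  fixes E :: "(real, 'n::finite) proj set"
  assumes "compact E" "E \<noteq> {}" "linear p" "linear q" "\<And>v. v \<in> lift E \<Longrightarrow> q v \<noteq> (0::real)"
  shows "\<exists>x\<in>lift E. \<forall>v\<in>lift E. p v / q v \<le> p x / q x"
proof (rule ccontr)
  assume contr: "\<not> ?thesis"
  define W where "W x = {v. q v \<noteq> 0 \<and> p v / q v < p x / q x}" for x
  define U where "U x = proj_of ` (W x - {0})" for x
  have "open (W x)" for x
  proof -
    have "open {v. q v \<noteq> 0}"
      by (intro open_Collect_neq continuous_intros linear_continuous_real assms)
    moreover have "continuous_on {v. q v \<noteq> 0} (\<lambda>v. p v / q v)"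
      by (intro continuous_intros linear_continuous_real assms) auto
    ultimately have "open ({v. q v \<noteq> 0} \<inter> (\<lambda>v. p v / q v) -` {..<p x / q x})"
      by (intro continuous_open_preimage) auto
    also have "{v. q v \<noteq> 0} \<inter> (\<lambda>v. p v / q v) -` {..<p x / q x} = W x" by (auto simp: W_def)
    finally show ?thesis .
  qed
  moreover have W_sc: "c *s v \<in> W x" if "c \<noteq> 0" "v \<in> W x" for c v x
    using that assms by (simp add: W_def scalar_mult_eq_scaleR linear_scale)
  ultimately have "open (U x)" and lift_U: "lift (U x) = W x - {0}" for x
    unfolding U_def by (intro open_proj_image lift_image; simp)+
  have "E \<subseteq> (\<Union>x\<in>lift E. U x)"
  proof
    fix P assume "P \<in> E"
    then obtain v where v: "v \<in> lift E" "P = proj_of v"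
      using proj_of_surj[of P] by (auto simp: lift_def)
    with contr obtain x where "x \<in> lift E" "p v / q v < p x / q x" by (auto simp: not_le)
    moreover from this v assms(5) have "v \<in> lift (U x)"
      unfolding lift_U by (auto simp: W_def lift_def)
    ultimately show "P \<in> (\<Union>x\<in>lift E. U x)" using v by (auto simp: lift_def)
  qed
  with \<open>compact E\<close> \<open>\<And>x. open (U x)\<close> obtain T where T: "T \<subseteq> lift E" "finite T" "E \<subseteq> (\<Union>x\<in>T. U x)"
    by (elim compactE_image) auto
  with \<open>E \<noteq> {}\<close> have "T \<noteq> {}" by auto
  with \<open>finite T\<close> have "Max ((\<lambda>v. p v / q v) ` T) \<in> (\<lambda>v. p v / q v) ` T" by (intro Max_in) auto
  then obtain x where x: "x \<in> T" "Max ((\<lambda>v. p v / q v) ` T) = p x / q x" by blast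
  have max: "p v / q v \<le> p x / q x" if "v \<in> T" for v
    unfolding x(2)[symmetric] using that \<open>finite T\<close> by (intro Max_ge) auto
  from x(1) T have "x \<in> lift E" by blast
  with T obtain y where "y \<in> T" "x \<in> lift (U y)" by (auto simp: lift_def)
  with max[of y] show False by (auto simp: lift_U W_def)
qed

text \<open>The derivative of the ratio along \<open>x + t *\<^sub>R y\<close> vanishes at the
  interior maximum \<open>t = 0\<close>, and its numerator \<open>p y * q x - p x * q y\<close> is
  zero just when the two ratios agree.\<close>

lemma open_max_ratio_const:
  fixes G :: "(real ^ 'n::finite) set"
  assumes "open G" "x \<in> G" and p: "linear p" and q: "linear q" and nz: "\<And>v. v \<in> G \<Longrightarrow> q v \<noteq> (0::real)"
    and max: "\<And>v. v \<in> G \<Longrightarrow> p v / q v \<le> p x / q x" and y: "y \<in> G"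
  shows "p y / q y = p x / q x"
proof -
  have "open ((\<lambda>t. x + t *\<^sub>R y) -` G)"
    by (intro open_vimage assms continuous_intros)
  moreover have "0 \<in> (\<lambda>t. x + t *\<^sub>R y) -` G" using assms by simp
  ultimately obtain e where e: "e > 0" "ball 0 e \<subseteq> (\<lambda>t. x + t *\<^sub>R y) -` G"
    using openE by blast
  have f: "p (x + t *\<^sub>R y) / q (x + t *\<^sub>R y) = (p x + t * p y) / (q x + t * q y)" for t
    using p q by (simp add: linear_add linear_scale)
  have qx: "q x \<noteq> 0" "q y \<noteq> 0" using nz assms by auto
  have "((\<lambda>t. (p x + t * p y) / (q x + t * q y)) has_real_derivative
      (p y * q x - p x * q y) / (q x * q x)) (at 0)"
    using qx by (auto intro!: derivative_eq_intros)
  moreover have "\<forall>t. \<bar>0 - t\<bar> < e \<longrightarrow> (p x + t * p y) / (q x + t * q y) \<le> (p x + 0 * p y) / (q x + 0 * q y)"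
    using e(2) max by (auto simp: f[symmetric] subset_iff)
  ultimately have "(p y * q x - p x * q y) / (q x * q x) = 0"
    using DERIV_local_max e(1) by blast
  then show ?thesis using qx by (simp add: divide_simps)
qed

text \<open>Openness or compactness enters here: on a compact set both extrema are attained, and on
  an open set attaining one makes the ratio constant. Minima are maxima for
  \<open>- p\<close>.\<close>

lemma ratio_max_iff_min:
  fixes E :: "(real, 'n::finite) proj set"
  assumes E: "open E \<or> compact E" "E \<noteq> {}" and p: "linear p" and q: "linear q"
    and nz: "\<And>v. v \<in> lift E \<Longrightarrow> q v \<noteq> (0::real)"
  shows "(\<exists>x\<in>lift E. \<forall>v\<in>lift E. p v / q v \<le> p x / q x) \<longleftrightarrow>
         (\<exists>x\<in>lift E. \<forall>v\<in>lift E. p x / q x \<le> p v / q v)"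
proof -
  have p': "linear (\<lambda>v. - p v)" using p by (rule linear_compose_neg)
  from E(1) show ?thesis
  proof
    assume "open E"
    show ?thesis
    proof (intro iffI; elim bexE)
      fix x assume x: "x \<in> lift E" "\<forall>v\<in>lift E. p v / q v \<le> p x / q x"
      have "p v / q v = p x / q x" if "v \<in> lift E" for v
        using x that nz by (intro open_max_ratio_const[OF open_lift[OF \<open>open E\<close>] x(1) p q]) auto
      with x(1) show "\<exists>x\<in>lift E. \<forall>v\<in>lift E. p x / q x \<le> p v / q v" by (metis order_refl)
    next
      fix x assume x: "x \<in> lift E" "\<forall>v\<in>lift E. p x / q x \<le> p v / q v"
      have "- p v / q v = - p x / q x" if "v \<in> lift E" for v
        using x that nz by (intro open_max_ratio_const[OF open_lift[OF \<open>open E\<close>] x(1) p' q]) auto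
      then have "p v / q v = p x / q x" if "v \<in> lift E" for v using that by force
      with x(1) show "\<exists>x\<in>lift E. \<forall>v\<in>lift E. p v / q v \<le> p x / q x" by (metis order_refl)
    qed
  next
    assume "compact E"
    have "\<exists>x\<in>lift E. \<forall>v\<in>lift E. p v / q v \<le> p x / q x"
      by (rule compact_attains_max_ratio[OF \<open>compact E\<close> E(2) p q nz])
    moreover have "\<exists>x\<in>lift E. \<forall>v\<in>lift E. - p v / q v \<le> - p x / q x"
      by (rule compact_attains_max_ratio[OF \<open>compact E\<close> E(2) p' q nz])
    ultimately show ?thesis by simp
  qed
qed

section \<open>Rotation into a quadrant and the reverse inclusion\<close>

text \<open>The closed hull of \<open>A\<close> has length at most \<open>pi / 2\<close> and is
  centred in the target interval. A point could only fail if the length is exactly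
  \<open>pi / 2\<close> and an end is attained; then both ends are, against the strict bound
  \<open>diam\<close>.\<close>

lemma shift_into_quadrant:
  fixes A :: "real set"
  assumes ne: "A \<noteq> {}" and diam: "\<And>a b. a \<in> A \<Longrightarrow> b \<in> A \<Longrightarrow> a - b < pi / 2"
    and ends: "(\<exists>b\<in>A. \<forall>a\<in>A. a \<le> b) \<longleftrightarrow> (\<exists>b\<in>A. \<forall>a\<in>A. b \<le> a)"
  shows "\<exists>\<psi>. \<forall>a\<in>A. 0 < a - \<psi> \<and> a - \<psi> < pi / 2"
proof -
  from ne obtain a0 where a0: "a0 \<in> A" by blast
  have bdd: "bdd_above A" "bdd_below A"
    using diam[OF _ a0] diam[OF a0]
    by (intro bdd_aboveI[of _ "a0 + pi / 2"] bdd_belowI[of _ "a0 - pi / 2"]; smt (verit))+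
  have bounds: "Inf A \<le> a" "a \<le> Sup A" if "a \<in> A" for a
    using that bdd by (auto intro: cInf_lower cSup_upper)
  have width: "Sup A - Inf A \<le> pi / 2"
  proof -
    have "Sup A \<le> b + pi / 2" if "b \<in> A" for b
      using ne by (rule cSup_least) (use diam[OF _ that] in \<open>smt (verit)\<close>)
    then have "Sup A - pi / 2 \<le> b" if "b \<in> A" for b using that by (simp add: diff_le_eq)
    with ne have "Sup A - pi / 2 \<le> Inf A" by (rule cInf_greatest)
    then show ?thesis by simp
  qed
  define \<psi> where "\<psi> = (Sup A + Inf A) / 2 - pi / 4"
  have "0 < a - \<psi> \<and> a - \<psi> < pi / 2" if a: "a \<in> A" for a
  proof (rule ccontr)
    assume "\<not> ?thesis"
    with bounds[OF a] width have *: "Sup A - Inf A = pi / 2" "a = Inf A \<or> a = Sup A"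
      unfolding \<psi>_def by (auto simp: field_simps; linarith)+
    from *(2) have "(\<exists>b\<in>A. \<forall>a\<in>A. a \<le> b) \<or> (\<exists>b\<in>A. \<forall>a\<in>A. b \<le> a)"
      using a bounds by blast
    with ends obtain b c where "b \<in> A" "\<forall>a\<in>A. a \<le> b" "c \<in> A" "\<forall>a\<in>A. c \<le> a" by blast
    then have "Sup A = b" "Inf A = c" by (auto intro: cSup_eq_maximum cInf_eq_minimum)
    with diam[of b c] *(1) \<open>b \<in> A\<close> \<open>c \<in> A\<close> show False by simp
  qed
  then show ?thesis by blast
qed

text \<open>The angle is that of the line through \<open>0\<close> and \<open>z\<close>, taken
  between \<open>- pi / 2\<close> and \<open>pi / 2\<close>; the radius is therefore signed and
  carries the sign of \<open>Re z\<close>.\<close>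

lemma polar_form:
  fixes z :: complex
  assumes "Re z \<noteq> 0"
  shows "z = of_real (Re z / cos (arctan (Im z / Re z))) * cis (arctan (Im z / Re z))"
proof -
  let ?f = "arctan (Im z / Re z)"
  have "cos ?f \<noteq> 0" using cos_arctan_not_zero by blast
  moreover have "sin ?f = Im z / Re z * cos ?f"
    using tan_arctan[of "Im z / Re z"] \<open>cos ?f \<noteq> 0\<close> by (simp add: tan_def field_simps)
  ultimately show ?thesis using assms by (simp add: complex_eq_iff)
qed

lemma dual_of_tube_subset:
  fixes E :: "(real, 'n::finite) proj set"
  assumes E: "open E \<or> compact E" "E \<noteq> {}" and conv: "proj_convex E"
  shows "dual_complement (elliptic_tube E) \<subseteq> elliptic_tube (dual_complement E)"
proof
  fix P assume P: "P \<in> dual_complement (elliptic_tube E)"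
  obtain z where z: "z \<noteq> 0" "P = proj_of z" using proj_of_surj by blast
  define \<zeta> where "\<zeta> x = pairing z (complexify x)" for x
  let ?G = "lift E"
  have lin: "linear \<zeta>" unfolding \<zeta>_def by (rule linear_pairing_complexify)
  have nz: "\<zeta> x + \<i> * \<zeta> y \<noteq> 0" if "pos_cone x y \<subseteq> ?G" for x y
  proof -
    have "x \<noteq> 0" using that pos_cone_left[of x y] by (auto simp: lift_def)
    then have "cvec x y \<in> lift (elliptic_tube E)"
      using that unfolding elliptic_tube_eq lift_def by (auto simp: cvec_eq_0_iff lift_def)
    with P z show ?thesis by (simp add: mem_dual_complement_iff \<zeta>_def pairing_cvec[symmetric])
  qed
  from \<open>E \<noteq> {}\<close> obtain x0 where x0: "x0 \<in> ?G"
    using proj_of_surj unfolding lift_def by (metis (mono_tags, lifting) ex_in_conv mem_Collect_eq)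
  define \<mu> where "\<mu> = cnj (\<zeta> x0)"
  define \<eta> where "\<eta> x = \<zeta> x * \<mu>" for x
  have signs: "x \<in> ?G \<Longrightarrow> Re (\<eta> x) \<noteq> 0"
    "x \<in> ?G \<Longrightarrow> y \<in> ?G \<Longrightarrow> Re (\<eta> x) * Re (\<eta> y) * Re (\<eta> x * cnj (\<eta> y)) > 0" for x y
    unfolding \<eta>_def \<mu>_def
    by (rule consistent_signs[OF lin x0]; use proj_convex_pos_cone[OF conv] nz in blast)+
  have "\<mu> \<noteq> 0" using signs(1)[OF x0] by (auto simp: \<eta>_def)
  define f where "f x = arctan (Im (\<eta> x) / Re (\<eta> x))" for x
  define r where "r x = Re (\<eta> x) / cos (f x)" for x
  have cos_pos: "cos (f x) > 0" for x
    unfolding f_def by (intro cos_gt_zero_pi) (use arctan_bounded in auto)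
  have polar: "\<eta> x = of_real (r x) * cis (f x)" if "x \<in> ?G" for x
    using polar_form[OF signs(1)[OF that]] by (simp add: f_def r_def)
  have diam: "f x - f y < pi / 2" if "x \<in> ?G" "y \<in> ?G" for x y
  proof (rule ccontr)
    assume "\<not> ?thesis"
    moreover have "f x - f y < pi"
      using arctan_bounded[of "Im (\<eta> x) / Re (\<eta> x)"] arctan_bounded[of "Im (\<eta> y) / Re (\<eta> y)"]
      by (simp add: f_def)
    ultimately have "cos (pi - (f x - f y)) \<ge> 0"
      by (intro cos_ge_zero) auto
    then have le: "cos (f x - f y) \<le> 0" by (simp add: cos_diff)
    have "\<eta> x * cnj (\<eta> y) = of_real (r x * r y) * cis (f x - f y)"
      by (simp add: polar[OF that(1)] polar[OF that(2)] complex_eq_iff cos_diff sin_diff algebra_simps)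
    then have "Re (\<eta> x * cnj (\<eta> y)) = r x * r y * cos (f x - f y)"
      by (simp only: Re_complex_of_real cis.sel times_complex.sel Im_complex_of_real mult_zero_left diff_zero)
    \<comment> \<open>Since \<open>r\<close> has the sign of \<open>Re (\<eta> x)\<close>, the
      product turns into a square times the cosine of the angle difference, over positive
      cosines.\<close>
    then have "Re (\<eta> x) * Re (\<eta> y) * Re (\<eta> x * cnj (\<eta> y))
        = (Re (\<eta> x) * Re (\<eta> y))\<^sup>2 * cos (f x - f y) / (cos (f x) * cos (f y))"
      by (simp only: r_def power2_eq_square) (simp add: field_simps)
    also have "\<dots> \<le> 0"
      using le cos_pos[of x] cos_pos[of y] by (intro divide_nonpos_pos mult_nonneg_nonpos) auto
    finally show False using signs(2)[OF that] by simp
  qed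
  have lin_\<eta>: "linear (\<lambda>x. Im (\<eta> x))" "linear (\<lambda>x. Re (\<eta> x))"
    using lin by (auto intro!: linearI simp: \<eta>_def linear_add linear_scale algebra_simps)
  \<comment> \<open>As \<open>arctan\<close> is increasing, extremal angles are extremal ratios of
    the linear maps \<open>Im (\<eta> x)\<close> and \<open>Re (\<eta> x)\<close>.\<close>
  have "(\<exists>b\<in>f ` ?G. \<forall>a\<in>f ` ?G. a \<le> b) \<longleftrightarrow> (\<exists>b\<in>f ` ?G. \<forall>a\<in>f ` ?G. b \<le> a)"
    using ratio_max_iff_min[OF E lin_\<eta>] signs(1) by (simp add: f_def arctan_le_iff)
  moreover have "f ` ?G \<noteq> {}" using x0 by blast
  moreover have "a - b < pi / 2" if "a \<in> f ` ?G" "b \<in> f ` ?G" for a b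
    using that diam by auto
  ultimately have "\<exists>\<psi>. \<forall>a\<in>f ` ?G. 0 < a - \<psi> \<and> a - \<psi> < pi / 2"
    by (intro shift_into_quadrant)
  then obtain \<psi> where "\<And>a. a \<in> f ` ?G \<Longrightarrow> 0 < a - \<psi> \<and> a - \<psi> < pi / 2"
    by blast
  then have \<psi>: "0 < f x - \<psi> \<and> f x - \<psi> < pi / 2" if "x \<in> ?G" for x
    using that by blast
  \<comment> \<open>Multiplying \<open>z\<close> by \<open>l\<close> leaves the point
    \<open>P\<close> unchanged and turns the values on the lift by \<open>- \<psi>\<close> into the
    open first and third quadrants.\<close>
  define l where "l = \<mu> * cis (- \<psi>)"
  have "l \<noteq> 0" using \<open>\<mu> \<noteq> 0\<close> by (simp add: l_def)
  define u w where "u = (\<chi> i. Re ((l *s z) $ i))" and "w = (\<chi> i. Im ((l *s z) $ i))"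
  have uw: "cvec u w = l *s z" unfolding u_def w_def by (rule cvec_surj[symmetric])
  have quadrant: "pairing u x * pairing w x > 0" if x: "x \<in> ?G" for x
  proof -
    have "Complex (pairing u x) (pairing w x) = l * \<zeta> x"
      unfolding pairing_complexify[symmetric] uw \<zeta>_def by (rule pairing_scale_left)
    also have "\<dots> = \<eta> x * cis (- \<psi>)" by (simp add: l_def \<eta>_def)
    also have "\<dots> = of_real (r x) * cis (f x - \<psi>)"
      unfolding polar[OF x] by (simp add: cis_mult mult.assoc)
    finally have "pairing u x = r x * cos (f x - \<psi>)" "pairing w x = r x * sin (f x - \<psi>)"
      by (simp_all add: complex_eq_iff)
    moreover have "cos (f x - \<psi>) > 0" "sin (f x - \<psi>) > 0"
      using \<psi>[OF x] by (auto intro!: cos_gt_zero sin_gt_zero)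
    moreover have "r x \<noteq> 0" using signs(1)[OF x] cos_pos[of x] by (simp add: r_def)
    ultimately have "(r x)\<^sup>2 * (cos (f x - \<psi>) * sin (f x - \<psi>)) > 0"
      by (intro mult_pos_pos) auto
    then show ?thesis
      using \<open>pairing u x = _\<close> \<open>pairing w x = _\<close> by (simp add: power2_eq_square mult_ac)
  qed
  have "pos_cone u w \<subseteq> lift (dual_complement E)"
  proof
    fix v assume "v \<in> pos_cone u w"
    then obtain a b where v: "v = a *s u + b *s w" "a \<ge> 0" "b \<ge> 0" "a > 0 \<or> b > 0"
      unfolding pos_cone_def scalar_mult_eq_scaleR by blast
    have *: "pairing v x \<noteq> 0" if "x \<in> ?G" for x
    proof -
      have "a * pairing u x + b * pairing w x \<noteq> 0"
        using quadrant[OF that] v(2-4) by (smt (verit) mult_nonneg_nonneg mult_pos_pos mult_nonneg_nonpos mult_pos_neg zero_less_mult_iff)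
      then show ?thesis by (simp add: v(1) pairing_add_left pairing_scale_left)
    qed
    then have "v \<noteq> 0" using x0 by (auto simp: pairing_def)
    with * show "v \<in> lift (dual_complement E)"
      by (auto simp: lift_def[of "dual_complement E"] mem_dual_complement_iff)
  qed
  moreover have "P = proj_of (cvec u w)"
    unfolding uw z using \<open>l \<noteq> 0\<close> z by (simp add: proj_of_scale)
  ultimately show "P \<in> elliptic_tube (dual_complement E)"
    unfolding elliptic_tube_eq by blast
qed

theorem corollary3p6:
  fixes D :: "(real, 'n::finite) proj set"
  assumes "CARD('n) \<ge> 2"
    and "open D \<or> compact D"
    and "properly_convex D"
  shows "dual_complement (elliptic_tube D) = elliptic_tube (dual_complement D)"
proof -
  \<comment> \<open>The empty set would lie in a hyperplane.\<close>
  have "D \<noteq> {}"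
    using assms(3) unfolding properly_convex_def projective_hyperplane_def by blast
  with assms show ?thesis
    unfolding properly_convex_def
    by (intro equalityI dual_of_tube_subset tube_of_dual_subset) auto
qed

end
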